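(* Let $n\ge1$ and let $\mathcal{C}$ be the binary $[2^n-1,n]$ simplex code. Then $\mathcal{C}$ is a functional $(s,2^{n-1})$-batch code for every integer $s$ with $1\le s\le\min\{4,2^{n-1}\}$.
   Context: The binary $[2^n-1,n]$ simplex code is the binary linear code whose $n\times(2^n-1)$ generator matrix $\mathbf{G}=[\mathbf{g}_1,\dots,\mathbf{g}_{2^n-1}]$ has as columns all nonzero vectors of $\mathbb{F}_2^n$ (each exactly once). A binary linear code with generator matrix $\mathbf{G}=[\mathbf{g}_1,\dots,\mathbf{g}_N]\in\mathbb{F}_2^{n\times N}$ with nonzero columns is a functional $(s,t)$-batch code ($1\le s\le t$) if for every multiset of request vectors $I=\{\mathbf{v}_1^{(a_1)},\dots,\mathbf{v}_s^{(a_s)}\}$, i.e. nonzero vectors $\mathbf{v}_1,\dots,\mathbf{v}_s\in\mathbb{F}_2^n$ (not necessarily distinct) with multiplicities $a_i\ge1$ and $\sum_i a_i=t$, there exist $t$ pairwise disjoint sets $R_{i,j}\subseteq[N]$ ($i\in[s]$, $j\in[a_i]$) with $\sum_{l\in R_{i,j}}\mathbf{g}_l=\mathbf{v}_i$ for all $i,j$. *)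

theory Defs
  imports Main "HOL-Library.Z2"
begin

definition F2vec :: "nat \<Rightarrow> (nat \<Rightarrow> bit) set" where
  "F2vec n = {v. \<forall>i\<ge>n. v i = 0}"

text \<open>Generator matrix with columns g 0, ..., g (N-1), all in F_2^n.
  The simplex code: the columns enumerate all nonzero vectors of F_2^n, each exactly once.\<close>
definition simplex_generator :: "nat \<Rightarrow> (nat \<Rightarrow> nat \<Rightarrow> bit) \<Rightarrow> bool" where
  "simplex_generator n g \<longleftrightarrow> bij_betw g {..<2^n - 1} (F2vec n - {\<lambda>_. 0})"

text \<open>Functional (s,t)-batch code for the code generated by columns g 0..g (N-1).
  Requests: v 0..v (s-1) nonzero in F_2^n (not necessarily distinct) with multiplicities
  a i >= 1 summing to t; recovery sets R i j (i<s, j<a i) pairwise disjoint subsets of [N].\<close>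
definition functional_batch_code ::
    "nat \<Rightarrow> nat \<Rightarrow> (nat \<Rightarrow> nat \<Rightarrow> bit) \<Rightarrow> nat \<Rightarrow> nat \<Rightarrow> bool" where
  "functional_batch_code n N g s t \<longleftrightarrow>
     (\<forall>v a. (\<forall>i<s. v i \<in> F2vec n - {\<lambda>_. 0}) \<and> (\<forall>i<s. 1 \<le> a i) \<and> (\<Sum>i<s. a i) = t \<longrightarrow>
        (\<exists>R :: nat \<Rightarrow> nat \<Rightarrow> nat set.
           (\<forall>i<s. \<forall>j<a i. R i j \<subseteq> {..<N} \<and> (\<lambda>k. \<Sum>l\<in>R i j. g l k) = v i) \<and>
           (\<forall>i<s. \<forall>j<a i. \<forall>i'<s. \<forall>j'<a i'. (i, j) \<noteq> (i', j') \<longrightarrow> R i j \<inter> R i' j' = {})))"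

end

theory Submission
  imports Defs "HOL.Vector_Spaces" "HOL-Library.Multiset" "HOL-Library.Disjoint_Sets"
    "HOL-Library.Function_Algebras"
begin

text \<open>
  The zero vector may be added as a fictitious column, so that the columns form a whole space \<open>V\<close>
  over the field with two elements, of twice the size of the request multiset \<open>M\<close>. Let \<open>U\<close> be the
  span of the requested vectors; its dimension is at most 4.

  If \<open>U = V\<close>, comparing \<open>dim V\<close> with the size of \<open>M\<close> shows that the requests are pairwise distinct,
  hence served by single columns, or that they are supported on a basis of \<open>V\<close> of size 3 or 4. In
  the latter case their multiplicities form a partition of 4 into 3 parts or of 8 into 4 parts, and
  there is an explicit solution for each of these six partitions.

  If \<open>U\<close> is smaller than \<open>V\<close>, write \<open>M = L + (N + N)\<close>, where \<open>L\<close> is empty or has exactly the size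
  that allows \<open>U\<close> to serve it by induction; there is room for this, as at most four
  multiplicities are odd. The rest \<open>N + N\<close> is served by a union of cosets of the span of \<open>N\<close>: peel
  off one coset at a time, together with as many requests as it can serve. This ends at the span of
  a single vector or at a 4-cube with each of its four directions requested twice.
\<close>

section \<open>Elementary abelian 2-groups as vector spaces over the field with two elements\<close>

class boolean_group = ab_group_add +
  assumes add_self [simp]: "x + x = 0"
begin

lemma add_self_left [simp]: "x + (x + y) = y"
  by (simp add: add.assoc [symmetric])

end

instance bit :: boolean_group
  by standard simp

instance "fun" :: (type, boolean_group) boolean_group
  by standard (simp add: fun_eq_iff)

definition bit_scale :: "bit \<Rightarrow> 'a::boolean_group \<Rightarrow> 'a" where
  "bit_scale c x = (if c = 1 then x else 0)"

global_interpretation F2: vector_space bit_scale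
  by standard (auto simp: bit_scale_def)

lemma subspace_iff: "F2.subspace U \<longleftrightarrow> 0 \<in> U \<and> (\<forall>x\<in>U. \<forall>y\<in>U. x + y \<in> U)"
  by (auto simp: F2.subspace_def bit_scale_def)

lemma span_insert_eq_Un: "F2.span (insert v S) = F2.span S \<union> (+) v ` F2.span S"
proof (rule set_eqI)
  fix x
  have "(\<exists>k. x - bit_scale k v \<in> F2.span S) \<longleftrightarrow> x \<in> F2.span S \<or> x - v \<in> F2.span S"
    by (auto simp: bit_scale_def split: if_splits intro: exI[of _ 0] exI[of _ 1])
  moreover have "x \<in> (+) v ` F2.span S \<longleftrightarrow> x - v \<in> F2.span S"
    by (auto simp: image_iff intro: bexI[of _ "x - v"])
  ultimately show "x \<in> F2.span (insert v S) \<longleftrightarrow> x \<in> F2.span S \<union> (+) v ` F2.span S"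
    by (simp add: F2.span_insert)
qed

lemma finite_span: "finite S \<Longrightarrow> finite (F2.span S)"
  by (induction rule: finite_induct) (simp_all add: span_insert_eq_Un)

fun subset_sums :: "'a::boolean_group list \<Rightarrow> 'a list" where
  "subset_sums [] = [0]"
| "subset_sums (v # vs) = subset_sums vs @ map ((+) v) (subset_sums vs)"

lemma length_subset_sums: "length (subset_sums vs) = 2 ^ length vs"
  by (induction vs) auto

lemma set_subset_sums: "set (subset_sums vs) = F2.span (set vs)"
  by (induction vs) (simp_all add: span_insert_eq_Un)

lemma distinct_subset_sums:
  "distinct vs \<Longrightarrow> F2.independent (set vs) \<Longrightarrow> distinct (subset_sums vs)"
proof (induction vs)
  case (Cons v vs)
  then have "v \<notin> F2.span (set vs)" "F2.independent (set vs)"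
    by (auto simp: F2.independent_insert)
  moreover have "v + x \<notin> F2.span (set vs)" if "x \<in> F2.span (set vs)" for x
    using calculation that by (simp add: F2.span_add_eq2)
  ultimately show ?case
    using Cons by (auto simp: distinct_map set_subset_sums)
qed simp

lemma card_span_independent:
  assumes "finite B" "F2.independent B"
  shows "card (F2.span B) = 2 ^ card B"
proof -
  obtain vs where "set vs = B" "distinct vs"
    using finite_distinct_list[OF assms(1)] by blast
  then show ?thesis
    using assms(2) distinct_card[OF distinct_subset_sums[of vs]]
    by (auto simp: set_subset_sums length_subset_sums distinct_card)
qed

lemma obtain_finite_basis:
  assumes "finite S"
  obtains B where "B \<subseteq> S" "F2.independent B" "card B \<le> card S" "card (F2.span S) = 2 ^ card B"
proof -
  obtain B where B: "B \<subseteq> S" "F2.independent B" "S \<subseteq> F2.span B"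
    by (rule F2.maximal_independent_subset)
  have "finite B"
    using B(1) assms by (rule finite_subset)
  have "F2.span S = F2.span B"
    using B(1,3) by (auto simp: F2.span_eq intro: F2.span_base)
  then have "card (F2.span S) = 2 ^ card B"
    using card_span_independent[OF \<open>finite B\<close> B(2)] by simp
  moreover have "card B \<le> card S"
    using assms B(1) by (rule card_mono)
  ultimately show thesis
    using B(1,2) by (intro that)
qed

lemma card_subspace_power_of_two:
  assumes "F2.subspace V" "finite V"
  obtains n where "card V = 2 ^ n"
  using obtain_finite_basis[OF assms(2)] F2.span_eq_iff assms(1) by metis

lemma four_dvd_card_span:
  assumes "finite S" "p \<in> S" "q \<in> S" "p \<noteq> q" "p \<noteq> 0" "q \<noteq> 0"
  shows "4 dvd card (F2.span S)"
proof -
  obtain d where d: "card (F2.span S) = 2 ^ d"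
    by (rule card_subspace_power_of_two[OF F2.subspace_span finite_span[OF assms(1)]])
  have "{0, p, q} \<subseteq> F2.span S"
    using assms(2,3) by (auto intro: F2.span_zero F2.span_base)
  then have "card {0, p, q} \<le> card (F2.span S)"
    using assms(1) by (intro card_mono finite_span)
  then have "(2::nat) ^ 1 < 2 ^ d"
    using assms(4-6) by (simp add: d)
  then have "1 < d"
    by (rule power_less_imp_less_exp[rotated]) simp
  then have "(2::nat) ^ 2 dvd 2 ^ d"
    by (intro le_imp_power_dvd) simp
  then show ?thesis
    by (simp add: d)
qed

section \<open>Multisets\<close>

lemma card_set_mset_le_size: "card (set_mset M) \<le> size M"
  using size_mset_mono[OF mset_set_set_mset_msubset[of M]] by simp

lemma mset_set_set_mset_if_size_le:
  assumes "size M \<le> card (set_mset M)"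
  shows "M = mset_set (set_mset M)"
proof -
  have "mset_set (set_mset M) \<subseteq># M"
    by (rule mset_set_set_mset_msubset)
  moreover have "size M \<le> size (mset_set (set_mset M))"
    using assms by simp
  ultimately show ?thesis
    by (metis mset_subset_size not_le subset_mset.le_imp_less_or_eq)
qed

lemma obtain_summand_of_size:
  fixes M :: "'a multiset"
  assumes "m \<le> size M"
  obtains A B where "M = A + B" "size A = m"
proof -
  obtain xs where "mset xs = M" using ex_mset by blast
  with assms that[of "mset (take m xs)" "mset (drop m xs)"] show thesis
    by (auto simp flip: mset_append)
qed

lemma sum_replicate_mset_count: "(\<Sum>x\<in>set_mset M. replicate_mset (count M x) x) = M"
proof (rule multiset_eqI)
  fix y
  show "count (\<Sum>x\<in>set_mset M. replicate_mset (count M x) x) y = count M y"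
    by (cases "y \<in># M") (simp_all add: count_sum count_eq_zero_iff)
qed

lemma obtain_list_by_multiplicity:
  obtains xs where "distinct xs" "set xs = set_mset M" "sorted_wrt (\<lambda>x y. count M y \<le> count M x) xs"
proof -
  obtain ys where ys: "set ys = set_mset M" "distinct ys"
    using finite_distinct_list[OF finite_set_mset] by metis
  let ?xs = "rev (sort_key (count M) ys)"
  have "sorted_wrt (\<lambda>x y. count M y \<le> count M x) ?xs"
    using sorted_sort_key[of "count M" ys] unfolding sorted_wrt_rev sorted_wrt_map .
  moreover have "distinct ?xs" "set ?xs = set_mset M"
    using ys by simp_all
  ultimately show thesis by (rule that[rotated 2])
qed

lemma obtain_parity_split:
  obtains P N where "M = mset_set P + (N + N)" "finite P" "P \<subseteq> set_mset M"
proof -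
  have "\<exists>P N. M = mset_set P + (N + N) \<and> finite P \<and> P \<subseteq> set_mset M"
  proof (induction M)
    case (add x M)
    then obtain P N where PN: "M = mset_set P + (N + N)" "finite P" "P \<subseteq> set_mset M"
      by blast
    show ?case
    proof (cases "x \<in> P")
      case True
      then have "mset_set P = add_mset x (mset_set (P - {x}))"
        using PN(2) by (simp add: mset_set.remove)
      then have "add_mset x M = mset_set (P - {x}) + (add_mset x N + add_mset x N)"
        using PN(1) by simp
      moreover have "P - {x} \<subseteq> set_mset (add_mset x M)"
        using PN(3) by auto
      ultimately show ?thesis
        using PN(2) by blast
    next
      case False
      then have "add_mset x M = mset_set (insert x P) + (N + N)"
        using PN(1,2) by simp
      moreover have "insert x P \<subseteq> set_mset (add_mset x M)"
        using PN(3) by auto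
      ultimately show ?thesis
        using PN(2) by blast
    qed
  qed (auto intro: exI[of _ "{}"])
  with that show thesis by blast
qed

section \<open>Serving requests by disjoint sets of columns\<close>

inductive serves :: "'a::comm_monoid_add set \<Rightarrow> 'a multiset \<Rightarrow> bool" where
  empty: "serves W {#}"
| add: "serves (W - R) M \<Longrightarrow> finite R \<Longrightarrow> R \<subseteq> W \<Longrightarrow> serves W (add_mset (\<Sum>R) M)"

lemma serves_mono: "serves W M \<Longrightarrow> W \<subseteq> W' \<Longrightarrow> serves W' M"
proof (induction arbitrary: W' rule: serves.induct)
  case (add W R M)
  have "serves (W' - R) M"
    using add.prems by (intro add.IH) blast
  then show ?case
    using add.hyps add.prems by (intro serves.add) auto
qed (rule serves.empty)

lemma serves_Un:
  "serves A M \<Longrightarrow> serves B N \<Longrightarrow> A \<inter> B = {} \<Longrightarrow> serves (A \<union> B) (M + N)"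
proof (induction rule: serves.induct)
  case (empty W)
  then show ?case
    using serves_mono[of B N "W \<union> B"] by simp
next
  case (add A R M)
  have "A \<union> B - R = (A - R) \<union> B"
    using add by blast
  moreover have "serves (A - R \<union> B) (M + N)"
    using add.prems by (intro add.IH) auto
  ultimately have "serves (A \<union> B) (add_mset (\<Sum>R) (M + N))"
    using add.hyps by (intro serves.add) auto
  then show ?case by simp
qed

lemma serves_Diff_zero: "serves W M \<Longrightarrow> serves (W - {0}) M"
proof (induction rule: serves.induct)
  case (add W R M)
  have "W - {0} - (R - {0}) = W - R - {0}" by blast
  with add have "serves (W - {0}) (add_mset (\<Sum>(R - {0})) M)"
    by (intro serves.add) auto
  moreover have "\<Sum>(R - {0}) = \<Sum>R"
    using add.hyps by (intro sum.mono_neutral_left) auto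
  ultimately show ?case by simp
qed (rule serves.empty)

lemma serves_split:
  assumes "X \<subseteq> W" "serves X M" "serves (W - X) N"
  shows "serves W (M + N)"
  using serves_Un[OF assms(2,3)] assms(1) by (simp add: Un_absorb1)

lemma serves_imp_disjoint_family:
  assumes "serves W (image_mset f (mset_set J))" "finite J"
  obtains R where "\<forall>j\<in>J. R j \<subseteq> W \<and> \<Sum>(R j) = f j" "disjoint_family_on R J"
proof -
  have "\<exists>R. (\<forall>j\<in>J. R j \<subseteq> W \<and> \<Sum>(R j) = f j) \<and> disjoint_family_on R J"
    using assms
  proof (induction W "image_mset f (mset_set J)" arbitrary: J rule: serves.induct)
    case (empty W)
    then have "J = {}" by (auto simp: mset_set_empty_iff)
    then show ?case by (simp add: disjoint_family_on_def)
  next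
    case (add W R M)
    have "\<Sum>R \<in># image_mset f (mset_set J)"
      by (simp flip: add.hyps(5))
    then obtain j where j: "j \<in> J" "f j = \<Sum>R"
      using add.prems by auto
    then have "image_mset f (mset_set (J - {j})) = M"
      using add.hyps(5) add.prems by (simp add: mset_set.remove)
    then obtain S where S: "\<forall>i\<in>J - {j}. S i \<subseteq> W - R \<and> \<Sum>(S i) = f i"
      "disjoint_family_on S (J - {j})"
      using add.hyps(2) add.prems by (metis finite_Diff)
    have "\<forall>i\<in>J. (S(j := R)) i \<subseteq> W \<and> \<Sum>((S(j := R)) i) = f i"
      using S j add.hyps by auto
    moreover have "disjoint_family_on (S(j := R)) J"
      using S by (fastforce simp: disjoint_family_on_def)
    ultimately show ?case by blast
  qed
  with that show thesis by blast
qed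

lemma serves_image_imp_disjoint_family:
  assumes "inj_on g I" "serves (g ` I) (image_mset f (mset_set J))" "finite J"
  obtains R where "\<forall>j\<in>J. R j \<subseteq> I \<and> sum g (R j) = f j" "disjoint_family_on R J"
proof -
  obtain S where S: "\<forall>j\<in>J. S j \<subseteq> g ` I \<and> \<Sum>(S j) = f j" "disjoint_family_on S J"
    using assms(2,3) by (rule serves_imp_disjoint_family)
  define R where "R j = {i \<in> I. g i \<in> S j}" for j
  have "R j \<subseteq> I \<and> sum g (R j) = f j" if "j \<in> J" for j
  proof -
    have "g ` R j = S j"
      using S(1) that by (auto simp: R_def)
    moreover have "inj_on g (R j)"
      using assms(1) by (rule inj_on_subset) (auto simp: R_def)
    ultimately have "sum g (R j) = f j"
      using S(1) that sum.reindex[of g "R j" "\<lambda>x. x"] by simp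
    then show ?thesis
      by (auto simp: R_def)
  qed
  moreover have "disjoint_family_on R J"
    using S(2) by (fastforce simp: disjoint_family_on_def R_def)
  ultimately show thesis
    by (intro that[of R]) auto
qed

lemma serves_concat:
  "distinct (concat xss) \<Longrightarrow> serves (set (concat xss)) (mset (map sum_list xss))"
proof (induction xss)
  case (Cons xs xss)
  then have "set (concat (xs # xss)) - set xs = set (concat xss)" "distinct xs"
    by auto
  with Cons show ?case
    using serves.add[of "set (concat (xs # xss))" "set xs"]
    by (auto simp: distinct_sum_list_conv_Sum)
qed (simp add: serves.empty)

lemma serves_mset_set: "finite P \<Longrightarrow> P \<subseteq> W \<Longrightarrow> serves W (mset_set P)"
proof (induction arbitrary: W rule: finite_induct)
  case (insert v P)
  have "serves (W - {v}) (mset_set P)"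
    by (rule insert.IH) (use insert in auto)
  then have "serves W (add_mset (\<Sum>{v}) (mset_set P))"
    by (rule serves.add) (use insert.prems in auto)
  with insert.hyps show ?case by simp
qed (simp add: serves.empty)

lemma sum_list_map_add_even:
  "even (length xs) \<Longrightarrow> sum_list (map ((+) (x::'a::boolean_group)) xs) = sum_list xs"
proof (induction xs rule: induct_list012)
  case (3 y z zs)
  then show ?case by (simp add: ac_simps)
qed auto

lemma serves_translate_even:
  fixes x :: "'a::boolean_group"
  assumes "distinct (concat xss)" "\<forall>xs\<in>set xss. even (length xs)"
  shows "serves ((+) x ` set (concat xss)) (mset (map sum_list xss))"
proof -
  have "map sum_list (map (map ((+) x)) xss) = map sum_list xss"
    using assms(2) by (simp add: sum_list_map_add_even)
  moreover have "distinct (concat (map (map ((+) x)) xss))"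
    using assms(1) by (simp add: distinct_map flip: map_concat)
  moreover have "set (concat (map (map ((+) x)) xss)) = (+) x ` set (concat xss)"
    by (simp flip: map_concat)
  ultimately show ?thesis
    using serves_concat[of "map (map ((+) x)) xss"] by argo
qed

section \<open>Requests from a basis\<close>

lemma
  assumes "distinct vs" "F2.independent (set vs)" "mset xs \<subseteq># mset (subset_sums vs)"
  shows distinct_if_mset_subset_sums: "distinct xs"
    and set_subset_span_if_mset_subset_sums: "set xs \<subseteq> F2.span (set vs)"
proof -
  obtain ys where "mset (subset_sums vs) = mset (xs @ ys)"
    using assms(3) by (metis ex_mset mset_append mset_subset_eq_exists_conv)
  then have "distinct (subset_sums vs) = distinct (xs @ ys)" "set (subset_sums vs) = set (xs @ ys)"
    by (rule mset_eq_imp_distinct_iff, rule mset_eq_setD)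
  then show "distinct xs" "set xs \<subseteq> F2.span (set vs)"
    using distinct_subset_sums[OF assms(1,2)] by (auto simp: set_subset_sums)
qed

lemma serves_span_concat:
  assumes "distinct vs" "F2.independent (set vs)" "mset (concat xss) \<subseteq># mset (subset_sums vs)"
  shows "serves (F2.span (set vs)) (mset (map sum_list xss))"
  using serves_mono[OF serves_concat] distinct_if_mset_subset_sums[OF assms]
    set_subset_span_if_mset_subset_sums[OF assms] by blast

lemma serves_coset_span_concat:
  assumes "distinct vs" "F2.independent (set vs)" "mset (concat xss) \<subseteq># mset (subset_sums vs)"
    and "\<forall>xs\<in>set xss. even (length xs)"
  shows "serves ((+) x ` F2.span (set vs)) (mset (map sum_list xss))"
  using serves_mono[OF serves_translate_even image_mono] distinct_if_mset_subset_sums[OF assms(1-3)]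
    set_subset_span_if_mset_subset_sums[OF assms(1-3)] assms(4) by blast

lemma serves_span_211:
  assumes "distinct [a, b, c]" "F2.independent {a, b, c}"
  shows "serves (F2.span {a, b, c}) {#a, a, b, c#}"
  using serves_span_concat[of "[a, b, c]" "[[a], [b], [c], [b+c, a+(b+c)]]"] assms
  by (simp add: ac_simps add_mset_commute)

context
  fixes a b c d :: "'a::boolean_group"
  assumes dist: "distinct [a, b, c, d]" and indep: "F2.independent {a, b, c, d}"
begin

lemma serves_span_5111: "serves (F2.span {a, b, c, d}) {#a, a, a, a, a, b, c, d#}"
  using dist indep serves_span_concat[of "[a, b, c, d]" "[[a], [b], [c], [d], [b+c, a+(b+c)],
    [b+d, a+(b+d)], [c+d, a+(c+d)], [b+(c+d), a+(b+(c+d))]]"]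
  by (simp add: ac_simps add_mset_commute)

lemma serves_span_4211: "serves (F2.span {a, b, c, d}) {#a, a, a, a, b, b, c, d#}"
  using dist indep serves_span_concat[of "[a, b, c, d]" "[[a], [b], [c], [d], [c+d, a+(c+d)],
    [b+d, a+(b+d)], [b+(c+d), a+(b+(c+d))], [a+c, a+(b+c)]]"]
  by (simp add: ac_simps add_mset_commute)

lemma serves_span_3311: "serves (F2.span {a, b, c, d}) {#a, a, a, b, b, b, c, d#}"
  using dist indep serves_span_concat[of "[a, b, c, d]" "[[a], [b], [c], [d], [b+c, a+(b+c)],
    [b+d, a+(b+d)], [c+d, b+(c+d)], [a+(c+d), a+(b+(c+d))]]"]
  by (simp add: ac_simps add_mset_commute)

lemma serves_span_3221: "serves (F2.span {a, b, c, d}) {#a, a, a, b, b, c, c, d#}"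
  using dist indep serves_span_concat[of "[a, b, c, d]" "[[a], [b], [c], [d], [c+d, a+(c+d)],
    [b+(c+d), a+(b+(c+d))], [a+d, a+(b+d)], [a+b, a+(b+c)]]"]
  by (simp add: ac_simps add_mset_commute)

text \<open>The pairs form a perfect matching of the 4-cube with two edges in each direction.\<close>

lemma serves_coset_span_2222:
  "serves ((+) x ` F2.span {a, b, c, d}) {#a, a, b, b, c, c, d, d#}"
  using dist indep serves_coset_span_concat[of "[a, b, c, d]" "[[0, a], [b, a+b], [c, b+c],
    [a+c, a+(c+d)], [a+(b+c), a+(b+(c+d))], [d, c+d], [a+d, a+(b+d)], [b+d, b+(c+d)]]" x]
  by (simp add: ac_simps add_mset_commute)

end

lemma partitions_of_8_into_4_parts:
  fixes i j k l :: nat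
  assumes "i + j + k + l = 8" "j \<le> i" "k \<le> j" "l \<le> k" "0 < l"
  shows "(i, j, k, l) \<in> {(5, 1, 1, 1), (4, 2, 1, 1), (3, 3, 1, 1), (3, 2, 2, 1), (2, 2, 2, 2)}"
proof -
  have "l \<le> 2" "k \<le> 2" "j \<le> 3"
    using assms by linarith+
  then have "l \<in> {1, 2}" "k \<in> {1, 2}" "j \<in> {1, 2, 3}"
    using assms by auto
  then show ?thesis
    using assms by (elim insertE emptyE) simp_all
qed

lemma serves_span_independent_3:
  assumes "F2.independent (set_mset M)" "card (set_mset M) = 3" "size M = 4"
  shows "serves (F2.span (set_mset M)) M"
proof -
  define B where "B = set_mset M"
  have "mset_set B \<subseteq># M"
    unfolding B_def by (rule mset_set_set_mset_msubset)
  then obtain A where A: "M = mset_set B + A"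
    by (auto simp: subset_mset.le_iff_add)
  have "card B = 3"
    using assms(2) by (simp add: B_def)
  then have "size A = 1"
    using assms(3) by (simp add: A)
  then obtain a where a: "A = {#a#}"
    using size_1_singleton_mset by blast
  have "a \<in> B"
    unfolding B_def by (simp add: A a)
  with \<open>card B = 3\<close> have "card (B - {a}) = 2"
    by simp
  then obtain b c where "B - {a} = {b, c}" "b \<noteq> c"
    by (meson card_2_iff)
  then have B_eq: "B = {a, b, c}" and dist: "distinct [a, b, c]"
    using \<open>a \<in> B\<close> by auto
  then have "M = {#a, a, b, c#}"
    by (simp add: A a add_mset_commute)
  moreover have "F2.independent {a, b, c}"
    using assms(1) B_eq by (simp add: B_def)
  ultimately show ?thesis
    using serves_span_211[OF dist] B_eq by (simp flip: B_def)
qed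

lemma serves_span_independent_4:
  assumes "F2.independent (set_mset M)" "card (set_mset M) = 4" "size M = 8"
  shows "serves (F2.span (set_mset M)) M"
proof -
  obtain xs where xs: "distinct xs" "set xs = set_mset M"
    and sorted: "sorted_wrt (\<lambda>x y. count M y \<le> count M x) xs"
    by (rule obtain_list_by_multiplicity)
  then have "length xs = 4"
    using assms(2) distinct_card by metis
  then obtain a b c d where abcd: "xs = [a, b, c, d]"
    by (auto simp: numeral_eq_Suc length_Suc_conv)
  have set_M: "set_mset M = {a, b, c, d}" and dist: "distinct [a, b, c, d]"
    using xs abcd by auto
  define i j k l where "i = count M a" and "j = count M b" and "k = count M c" and "l = count M d"
  note counts = i_def j_def k_def l_def
  have M_eq: "M = replicate_mset i a + replicate_mset j b + replicate_mset k c + replicate_mset l d"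
    using sum_replicate_mset_count[of M] dist by (simp add: set_M counts ac_simps)
  have "i + j + k + l = 8"
    using assms(3) by (simp add: M_eq)
  moreover have "j \<le> i" "k \<le> j" "l \<le> k"
    using sorted by (simp_all add: abcd counts)
  moreover have "0 < l"
    by (simp add: counts set_M)
  ultimately have "(i, j, k, l) \<in> {(5, 1, 1, 1), (4, 2, 1, 1), (3, 3, 1, 1), (3, 2, 2, 1), (2, 2, 2, 2)}"
    by (rule partitions_of_8_into_4_parts)
  moreover have "F2.independent {a, b, c, d}"
    using assms(1) by (simp add: set_M)
  note serves_span_5111[OF dist this] serves_span_4211[OF dist this] serves_span_3311[OF dist this]
      serves_span_3221[OF dist this] serves_coset_span_2222[OF dist this, of 0]
  ultimately show ?thesis
    unfolding set_M by (elim insertE emptyE) (simp_all add: M_eq numeral_eq_Suc add_mset_commute)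
qed

section \<open>Requests of even multiplicity\<close>

definition stable_under :: "'a::plus set \<Rightarrow> 'a set \<Rightarrow> bool" where
  "stable_under S W \<longleftrightarrow> (\<forall>w\<in>W. \<forall>v\<in>S. w + v \<in> W)"

lemma stable_under_mono: "stable_under S W \<Longrightarrow> T \<subseteq> S \<Longrightarrow> stable_under T W"
  by (auto simp: stable_under_def)

lemma stable_under_subspace: "F2.subspace U \<Longrightarrow> S \<subseteq> U \<Longrightarrow> stable_under S U"
  by (auto simp: stable_under_def subspace_iff)

lemma stable_under_coset: "stable_under S U \<Longrightarrow> stable_under S ((+) (x::'a::boolean_group) ` U)"
  by (auto simp: stable_under_def add.assoc)

lemma stable_under_Diff:
  fixes W :: "'a::boolean_group set"
  assumes "stable_under S W" "stable_under S X"
  shows "stable_under S (W - X)"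
proof -
  have "w \<in> X" if "w + v \<in> X" "v \<in> S" for w v
  proof -
    have "(w + v) + v \<in> X"
      using assms(2) that unfolding stable_under_def by blast
    then show ?thesis by (simp add: add.assoc)
  qed
  with assms(1) show ?thesis
    unfolding stable_under_def by blast
qed

lemma coset_span_subset:
  assumes "stable_under S W" "x \<in> W"
  shows "(+) x ` F2.span S \<subseteq> W"
proof -
  have "x + u \<in> W" if "u \<in> F2.span S" for u
    using that
  proof (induction rule: F2.span_induct_alt)
    case (step c v u)
    then have "(x + u) + v \<in> W"
      using assms(1) unfolding stable_under_def by blast
    with step show ?case
      by (cases c) (simp_all add: bit_scale_def ac_simps)
  qed (simp add: assms(2))
  then show ?thesis by blast
qed

lemma obtain_coset:
  fixes W :: "'a::boolean_group set"
  assumes "stable_under S W" "W \<noteq> {}"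
  obtains x where "(+) x ` F2.span S \<subseteq> W" "stable_under S ((+) x ` F2.span S)"
    "card ((+) x ` F2.span S) = card (F2.span S)"
proof -
  obtain x where "x \<in> W"
    using assms(2) by blast
  show thesis
  proof (rule that)
    show "(+) x ` F2.span S \<subseteq> W"
      using assms(1) \<open>x \<in> W\<close> by (rule coset_span_subset)
    show "stable_under S ((+) x ` F2.span S)"
      by (intro stable_under_coset stable_under_subspace F2.subspace_span F2.span_superset)
  qed (simp add: card_image)
qed

lemma serves_replicate_mset:
  fixes v :: "'a::boolean_group"
  assumes "finite W" "stable_under {v} W" "v \<noteq> 0" "card W = 2 * m"
  shows "serves W (replicate_mset m v)"
  using assms
proof (induction m arbitrary: W)
  case (Suc m)
  then obtain x where x: "x \<in> W" by fastforce
  let ?R = "{x, x + v}"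
  have R: "?R \<subseteq> W" "x \<noteq> x + v"
    using Suc.prems x by (auto simp: stable_under_def)
  have "serves (W - ?R) (replicate_mset m v)"
  proof (rule Suc.IH)
    have "stable_under {v} ?R"
      by (auto simp: stable_under_def add.assoc)
    then show "stable_under {v} (W - ?R)"
      using Suc.prems by (intro stable_under_Diff)
    show "card (W - ?R) = 2 * m"
      using Suc.prems R by (subst card_Diff_subset) auto
  qed (use Suc.prems in auto)
  then have "serves W (add_mset (\<Sum>?R) (replicate_mset m v))"
    using R by (intro serves.add) auto
  moreover have "\<Sum>?R = v"
    using R by simp
  ultimately show ?case by simp
qed (simp add: serves.empty)

lemma serves_doubled_single:
  fixes v :: "'a::boolean_group"
  assumes "finite W" "card W = 4 * size N" "stable_under {v} W" "v \<noteq> 0" "set_mset N \<subseteq> {v}"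
  shows "serves W (N + N)"
proof -
  have "N + N = replicate_mset (size (N + N)) v"
    using assms(5) set_mset_subset_singletonD[of "N + N" v] by simp
  then show ?thesis
    using serves_replicate_mset[of W v "size (N + N)"] assms(1-4) by simp
qed

lemma serves_coset_span_basis_doubled:
  assumes "F2.independent B" "card B = 4"
  shows "serves ((+) x ` F2.span B) (mset_set B + mset_set B)"
proof -
  obtain a b c d where "B = {a, b, c, d}" and dist: "distinct [a, b, c, d]"
    using assms(2) by (auto simp: numeral_eq_Suc card_Suc_eq)
  then show ?thesis
    using serves_coset_span_2222[OF dist, of x] assms(1)
    by (simp add: ac_simps add_mset_commute)
qed

lemma serves_full_coset_doubled:
  assumes "card (F2.span (set_mset N)) = 4 * size N" "card (set_mset N) \<le> 4"
  shows "serves ((+) x ` F2.span (set_mset N)) (N + N)"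
proof -
  define S where "S = set_mset N"
  have "finite S" "card S \<le> size N"
    by (simp_all add: S_def card_set_mset_le_size)
  obtain B where B: "B \<subseteq> S" "F2.independent B" "card B \<le> card S" "card (F2.span S) = 2 ^ card B"
    using \<open>finite S\<close> by (rule obtain_finite_basis)
  \<comment> \<open>the dimension \<open>d\<close> of the span satisfies \<open>d \<le> size N = 2 ^ (d - 2)\<close>, which forces \<open>d = 4\<close>\<close>
  have "card B \<in> {0, 1, 2, 3, 4}"
    using B(3) assms(2) by (auto simp: S_def)
  moreover have "2 ^ card B = 4 * size N"
    using B(4) assms(1) by (simp add: S_def)
  ultimately have card_B: "card B = 4" "size N = 4"
    using B(3) \<open>card S \<le> size N\<close> by auto
  then have "card S \<le> card B"
    using assms(2) by (simp add: S_def)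
  then have "B = S"
    using B(1) \<open>finite S\<close> by (intro card_seteq)
  then have "size N \<le> card (set_mset N)"
    using card_B by (simp add: S_def)
  then have "N = mset_set S"
    unfolding S_def by (rule mset_set_set_mset_if_size_le)
  then show ?thesis
    using serves_coset_span_basis_doubled[OF B(2) card_B(1), of x] \<open>B = S\<close> by (metis S_def)
qed

lemma obtain_coset_split:
  fixes W :: "'a::boolean_group set"
  assumes W: "finite W" "card W = 4 * size N" "stable_under (set_mset N) W"
    and N: "p \<in># N" "q \<in># N" "p \<noteq> q" "0 \<notin># N"
  obtains (coset) x where "W = (+) x ` F2.span (set_mset N)" "card (F2.span (set_mset N)) = 4 * size N"
  | (split) A B X where "N = A + B" "A \<noteq> {#}" "B \<noteq> {#}" "X \<subseteq> W" "card X = 4 * size A"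
      "card (W - X) = 4 * size B" "stable_under (set_mset N) X" "stable_under (set_mset N) (W - X)"
proof -
  have "W \<noteq> {}"
    using W(2) N(1) by auto
  with W(3) obtain x where X: "(+) x ` F2.span (set_mset N) \<subseteq> W"
    "stable_under (set_mset N) ((+) x ` F2.span (set_mset N))"
    "card ((+) x ` F2.span (set_mset N)) = card (F2.span (set_mset N))"
    by (rule obtain_coset)
  let ?X = "(+) x ` F2.span (set_mset N)"
  have "p \<noteq> 0" "q \<noteq> 0"
    using N by auto
  with N(1-3) have "4 dvd card (F2.span (set_mset N))"
    by (intro four_dvd_card_span finite_set_mset)
  then obtain m where m: "card (F2.span (set_mset N)) = 4 * m"
    by (rule dvdE)
  have "m \<le> size N"
    using card_mono[OF W(1) X(1)] X(3) m W(2) by simp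
  then obtain A B where N_eq: "N = A + B" and size_A: "size A = m"
    by (rule obtain_summand_of_size)
  have card_Diff: "card (W - ?X) = 4 * size B"
    using W(1,2) X(1,3) m N_eq size_A finite_subset[OF X(1)] by (simp add: card_Diff_subset)
  show thesis
  proof (cases "B = {#}")
    case True
    then have "W = ?X"
      using card_Diff X(1) W(1) by auto
    then show thesis
      using m N_eq size_A True by (intro coset) auto
  next
    case False
    moreover have "card (F2.span (set_mset N)) \<noteq> 0"
      using F2.span_zero finite_span[OF finite_set_mset] by (auto simp: card_eq_0_iff)
    then have "A \<noteq> {#}"
      using m size_A by auto
    ultimately show thesis
      using N_eq X card_Diff m size_A W(3) by (intro split[of A B ?X] stable_under_Diff) auto
  qed
qed

lemma serves_doubled:
  fixes W :: "'a::boolean_group set"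
  assumes "finite W" "card W = 4 * size N" "stable_under (set_mset N) W"
    and "0 \<notin># N" "card (set_mset N) \<le> 4"
  shows "serves W (N + N)"
  using assms
proof (induction "size N" arbitrary: N W rule: less_induct)
  case less
  consider (none) "N = {#}" | (single) v where "v \<in># N" "set_mset N \<subseteq> {v}"
    | (distinct) p q where "p \<in># N" "q \<in># N" "p \<noteq> q"
    by blast
  then show ?case
  proof cases
    case none
    then show ?thesis by (simp add: serves.empty)
  next
    case single
    then show ?thesis
      using less.prems by (intro serves_doubled_single) (auto intro: stable_under_mono)
  next
    case distinct
    from less.prems(1-3) distinct less.prems(4) show ?thesis
    proof (cases rule: obtain_coset_split)
      case (coset x)
      then show ?thesis
        using serves_full_coset_doubled[of N x] less.prems(5) by simp
    next
      case (split A B X)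
      have "card (set_mset A) \<le> 4" "card (set_mset B) \<le> 4"
        using less.prems(5) split(1) card_mono[of "set_mset N" "set_mset A"]
          card_mono[of "set_mset N" "set_mset B"] by auto
      then have "serves X (A + A)" "serves (W - X) (B + B)"
        using split less.prems(1,4)
        by (auto intro!: less.hyps simp: nonempty_has_size intro: finite_subset stable_under_mono)
      with split(4) have "serves W ((A + A) + (B + B))"
        by (rule serves_split)
      then show ?thesis
        by (simp add: split(1) ac_simps)
    qed
  qed
qed

section \<open>Requests in a subspace\<close>

lemma serves_span:
  assumes "card (F2.span (set_mset M)) = 2 * size M" "card (set_mset M) \<le> 4"
  shows "serves (F2.span (set_mset M)) M"
proof (cases "size M \<le> card (set_mset M)")
  case True
  then have "M = mset_set (set_mset M)"
    by (rule mset_set_set_mset_if_size_le)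
  then show ?thesis
    by (metis F2.span_superset finite_set_mset serves_mset_set)
next
  case False
  obtain B where B: "B \<subseteq> set_mset M" "F2.independent B" "card B \<le> card (set_mset M)"
    and "card (F2.span (set_mset M)) = 2 ^ card B"
    using finite_set_mset by (rule obtain_finite_basis)
  then have size_M: "2 * size M = 2 ^ card B"
    using assms(1) by simp
  \<comment> \<open>the dimension \<open>d\<close> satisfies \<open>d < size M = 2 ^ (d - 1)\<close>\<close>
  have "card B \<in> {0, 1, 2, 3, 4}"
    using B(3) assms(2) by auto
  then have card_B: "card B = 3 \<or> card B = 4" "card (set_mset M) \<le> card B"
    using size_M B(3) False assms(2) by auto
  have "B = set_mset M"
    using B(1) card_B(2) by (intro card_seteq) auto
  with card_B(1) show ?thesis
    using size_M B(2) serves_span_independent_3[of M] serves_span_independent_4[of M] by auto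
qed

lemma serves_extend_doubled:
  fixes V :: "'a::boolean_group set"
  assumes "F2.subspace U" "F2.subspace V" "U \<subseteq> V" "finite V"
    and "serves U M" "card V = card U + 4 * size N" "set_mset N \<subseteq> U - {0}" "card (set_mset N) \<le> 4"
  shows "serves V (M + (N + N))"
proof -
  have "card (V - U) = 4 * size N"
    using assms(3,4,6) by (simp add: card_Diff_subset finite_subset)
  moreover have "stable_under (set_mset N) (V - U)"
    using assms(1-3,7) by (intro stable_under_Diff stable_under_subspace) auto
  ultimately have "serves (V - U) (N + N)"
    using assms(4,7,8) by (intro serves_doubled) auto
  with assms(3,5) show ?thesis
    by (rule serves_split)
qed

lemma power_of_two_eq_twice_even_plus:
  fixes d p :: nat
  assumes "even p" "0 < p" "p \<le> 4" "p < 2 ^ d"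
  obtains k where "2 ^ d = 2 * p + 4 * k"
proof -
  have p: "p = 2 \<or> p = 4"
    using assms(1-3) by presburger
  show thesis
  proof (cases "d \<le> 2")
    case True
    then have "d \<in> {0, 1, 2}" by auto
    with p assms(4) have "2 ^ d = 2 * p + 4 * 0" by auto
    then show thesis by (rule that)
  next
    case False
    then have "3 \<le> d" by simp
    then obtain e where d: "d = 3 + e"
      using le_Suc_ex by blast
    from p have "p div 2 \<le> 2 * 2 ^ e"
      using one_le_power[of "2::nat" e] by auto
    then obtain k where "2 * 2 ^ e = p div 2 + k"
      using le_Suc_ex by blast
    with p have "2 ^ d = 2 * p + 4 * k"
      by (auto simp: d power_add)
    then show thesis by (rule that)
  qed
qed

lemma obtain_even_complement_of_size:
  fixes M :: "'a multiset"
  assumes "even (size M)" "card (set_mset M) \<le> 4" "card (set_mset M) < 2 ^ d" "2 ^ d < 2 * size M"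
  obtains (doubled) N where "M = N + N"
    | (remainder) L N where "M = L + (N + N)" "2 * size L = 2 ^ d"
proof -
  obtain P N where PN: "M = mset_set P + (N + N)" "finite P" "P \<subseteq> set_mset M"
    by (rule obtain_parity_split)
  show thesis
  proof (cases "P = {}")
    case True
    with PN(1) doubled show thesis by simp
  next
    case False
    have "card P \<le> card (set_mset M)"
      using PN(3) by (simp add: card_mono)
    moreover have "even (card P)"
      using assms(1) PN(1) by simp
    moreover have "0 < card P"
      using False PN(2) by (simp add: card_gt_0_iff)
    ultimately obtain k where k: "2 ^ d = 2 * card P + 4 * k"
      using power_of_two_eq_twice_even_plus[of "card P" d] assms(2,3) by auto
    then have "k \<le> size N"
      using assms(4) PN(1) by simp
    then obtain A B where "N = A + B" "size A = k"
      by (rule obtain_summand_of_size)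
    then show thesis
      using k PN(1) by (intro remainder[of "mset_set P + (A + A)" B]) (simp_all add: ac_simps)
  qed
qed

lemma obtain_even_complement_filling_span:
  fixes V :: "'a::boolean_group set"
  assumes "F2.subspace V" "finite V" "card V = 2 * size M"
    and "set_mset M \<subseteq> V - {0}" "card (set_mset M) \<le> 4"
    and "F2.span (set_mset M) \<noteq> V"
  obtains (doubled) N where "M = N + N"
    | (remainder) L N where "M = L + (N + N)" "card (F2.span (set_mset M)) = 2 * size L" "size L < size M"
proof -
  let ?U = "F2.span (set_mset M)"
  have "?U \<subseteq> V"
    using assms(1,4) by (intro F2.span_minimal) auto
  then have card_less: "card ?U < 2 * size M"
    using psubset_card_mono[of V ?U] assms(2,3,6) by auto
  have "finite ?U"
    by (simp add: finite_span)
  have "set_mset M \<subset> ?U"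
    using F2.span_superset[of "set_mset M"] F2.span_zero[of "set_mset M"] assms(4) by auto
  with \<open>finite ?U\<close> have set_less: "card (set_mset M) < card ?U"
    by (rule psubset_card_mono)
  obtain d n where d: "card ?U = 2 ^ d" and n: "card V = 2 ^ n"
    using card_subspace_power_of_two assms(1,2) F2.subspace_span \<open>finite ?U\<close> by meson
  have "M \<noteq> {#}"
    using n assms(3) by auto
  then have "0 < card (set_mset M)"
    by (simp add: card_gt_0_iff)
  then have "1 < size M"
    using set_less card_less by simp
  then have "even (size M)"
    using n assms(3) by (cases n) (auto intro: gr0I)
  then show thesis
    using assms(5) set_less[unfolded d] card_less[unfolded d]
  proof (cases rule: obtain_even_complement_of_size)
    case (doubled N)
    then show thesis by (rule that(1))
  next
    case (remainder L N)
    then show thesis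
      using card_less d by (intro that(2)[of L N]) auto
  qed
qed

theorem serves_subspace:
  fixes V :: "'a::boolean_group set"
  assumes "F2.subspace V" "finite V" "card V = 2 * size M"
    and "set_mset M \<subseteq> V - {0}" "card (set_mset M) \<le> 4"
  shows "serves V M"
  using assms
proof (induction "size M" arbitrary: M V rule: less_induct)
  case less
  let ?U = "F2.span (set_mset M)"
  show ?case
  proof (cases "?U = V")
    case True
    then show ?thesis
      using serves_span[of M] less.prems(3-5) by auto
  next
    case False
    with less.prems show ?thesis
    proof (cases rule: obtain_even_complement_filling_span)
      case (doubled N)
      then show ?thesis
        using less.prems by (auto intro: serves_doubled stable_under_subspace)
    next
      case (remainder L N)
      have U: "F2.subspace ?U" "?U \<subseteq> V" "set_mset M \<subseteq> ?U - {0}"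
        using less.prems(1,4) F2.span_superset[of "set_mset M"] F2.span_minimal[of "set_mset M" V]
        by auto
      have small: "card (set_mset L) \<le> 4" "card (set_mset N) \<le> 4"
        using less.prems(5) card_mono[of "set_mset M" "set_mset L"]
          card_mono[of "set_mset M" "set_mset N"] remainder(1) by auto
      have "serves ?U L"
        using U(3) remainder small by (intro less.hyps) (auto intro: finite_span)
      then have "serves V (L + (N + N))"
        using U less.prems(1-3) remainder small by (intro serves_extend_doubled[of ?U]) auto
      then show ?thesis by (simp add: remainder(1))
    qed
  qed
qed

section \<open>The simplex code\<close>

lemma subspace_F2vec: "F2.subspace (F2vec n)"
  by (auto simp: subspace_iff F2vec_def)

lemma finite_F2vec: "finite (F2vec n)" and card_F2vec: "card (F2vec n) = 2 ^ n"
proof -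
  have "bij_betw (\<lambda>A i. of_bool (i \<in> A)) (Pow {..<n}) (F2vec n)"
    by (rule bij_betw_byWitness[where f' = "\<lambda>v. {i. v i = 1}"]) (auto simp: F2vec_def fun_eq_iff not_le)
  from bij_betw_finite[OF this] bij_betw_same_card[OF this]
  show "finite (F2vec n)" "card (F2vec n) = 2 ^ n"
    by (simp_all add: card_Pow)
qed

lemma sum_fun_apply: "(\<Sum>l\<in>A. g l) k = (\<Sum>l\<in>A. (g l k :: 'b::comm_monoid_add))"
  by (induction A rule: infinite_finite_induct) auto

definition request_mset :: "nat \<Rightarrow> (nat \<Rightarrow> nat) \<Rightarrow> (nat \<Rightarrow> 'a) \<Rightarrow> 'a multiset" where
  "request_mset s a v = image_mset (\<lambda>(i, j). v i) (mset_set (SIGMA i:{..<s}. {..<a i}))"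

lemma size_request_mset: "size (request_mset s a v) = (\<Sum>i<s. a i)"
  by (simp add: request_mset_def)

lemma set_request_mset_subset: "set_mset (request_mset s a v) \<subseteq> v ` {..<s}"
  by (auto simp: request_mset_def)

lemma functional_batch_codeI:
  assumes "inj_on g {..<N}"
    and "\<And>v a. (\<forall>i<s. v i \<in> F2vec n - {0}) \<Longrightarrow> (\<Sum>i<s. a i) = t \<Longrightarrow>
      serves (g ` {..<N}) (request_mset s a v)"
  shows "functional_batch_code n N g s t"
  unfolding functional_batch_code_def
proof (intro allI impI, elim conjE)
  fix v :: "nat \<Rightarrow> nat \<Rightarrow> bit" and a :: "nat \<Rightarrow> nat"
  let ?J = "SIGMA i:{..<s}. {..<a i}"
  assume "\<forall>i<s. v i \<in> F2vec n - {\<lambda>_. 0}" "(\<Sum>i<s. a i) = t"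
  then have "serves (g ` {..<N}) (request_mset s a v)"
    using assms(2) by (simp add: zero_fun_def)
  then obtain R where
    R: "\<forall>j\<in>?J. R j \<subseteq> {..<N} \<and> sum g (R j) = (case j of (i, j) \<Rightarrow> v i)"
    and disjoint: "disjoint_family_on R ?J"
    unfolding request_mset_def by (rule serves_image_imp_disjoint_family[OF assms(1)]) auto
  show "\<exists>R. (\<forall>i<s. \<forall>j<a i. R i j \<subseteq> {..<N} \<and> (\<lambda>k. \<Sum>l\<in>R i j. g l k) = v i) \<and>
      (\<forall>i<s. \<forall>j<a i. \<forall>i'<s. \<forall>j'<a i'. (i, j) \<noteq> (i', j') \<longrightarrow> R i j \<inter> R i' j' = {})"
  proof (intro exI[of _ "\<lambda>i j. R (i, j)"] conjI allI impI)
    fix i j assume "i < s" "j < a i"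
    then show "R (i, j) \<subseteq> {..<N}" "(\<lambda>k. \<Sum>l\<in>R (i, j). g l k) = v i"
      using bspec[OF R, of "(i, j)"] by (auto simp flip: sum_fun_apply)
  next
    fix i j i' j' assume "i < s" "j < a i" "i' < s" "j' < a i'" "(i, j) \<noteq> (i', j')"
    then show "R (i, j) \<inter> R (i', j') = {}"
      using disjoint by (intro disjoint_family_onD) auto
  qed
qed

theorem mainTheorem12:
  fixes n s :: nat and g :: "nat \<Rightarrow> nat \<Rightarrow> bit"
  assumes "1 \<le> n"
    and "simplex_generator n g"
    and "1 \<le> s" and "s \<le> min 4 (2^(n-1))"
  shows "functional_batch_code n (2^n - 1) g s (2^(n-1))"
proof (rule functional_batch_codeI)
  have columns: "bij_betw g {..<2^n - 1} (F2vec n - {0})"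
    using assms(2) by (simp add: simplex_generator_def zero_fun_def)
  then show "inj_on g {..<2^n - 1}"
    by (rule bij_betw_imp_inj_on)
  fix v :: "nat \<Rightarrow> nat \<Rightarrow> bit" and a :: "nat \<Rightarrow> nat"
  assume nonzero: "\<forall>i<s. v i \<in> F2vec n - {0}" and total: "(\<Sum>i<s. a i) = 2^(n-1)"
  let ?M = "request_mset s a v"
  have "serves (F2vec n) ?M"
  proof (rule serves_subspace)
    show "card (F2vec n) = 2 * size ?M"
      using assms(1) total by (cases n) (simp_all add: card_F2vec size_request_mset)
    show "set_mset ?M \<subseteq> F2vec n - {0}"
      using set_request_mset_subset[of s a v] nonzero by auto
    show "card (set_mset ?M) \<le> 4"
      using surj_card_le[OF _ set_request_mset_subset[of s a v]] assms(4) by simp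
  qed (fact subspace_F2vec finite_F2vec)+
  then have "serves (F2vec n - {0}) ?M"
    by (rule serves_Diff_zero)
  then show "serves (g ` {..<2^n - 1}) ?M"
    by (simp only: bij_betw_imp_surj_on[OF columns])
qed

end
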